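(* Let $X=\mathbb{R}^n$, let $C_1,\dots,C_m\subset X$ be closed convex sets with $C=\bigcap_{i=1}^mC_i\ne\emptyset$, let $d\in X$ and $x^*=P_C(d)$. Consider the two conditions: (CQ1) if $\sum_{i=1}^m v_i=0$ and $v_i\in N_{C_i}(x^* )$ for all $i\in\{1,\dots,m\}$, then $v_i=0$ for all $i\in\{1,\dots,m\}$; (CQ2) if $\sum_{i=1}^{m+1}v_i=0$, $v_{m+1}\in N_C(x^* )$ and $v_i\in N_{C_i}(x^* )$ for all $i\in\{1,\dots,m\}$, then $v_i=0$ for all $i\in\{1,\dots,m+1\}$. Define $h(y_1,\dots,y_m)=\frac12\|d-(y_1+\cdots+y_m)\|^2+\sum_{i=1}^m\delta^*(y_i,C_i)$ on $X^m$ and $\bar h(y_1,\dots,y_{m+1})=\frac12\|d-(y_1+\cdots+y_{m+1})\|^2+\sum_{i=1}^m\delta^*(y_i,C_i)+\delta^*(y_{m+1},C)$ on $X^{m+1}$. Then: 1. If (CQ1) holds, then the iterates $\tilde y^{(k)}=(y_1^{(k)},\dots,y_m^{(k)})$ of Dykstra's algorithm are bounded. Moreover, an accumulation point exists and is a minimizer of $h$; consequently a minimizer $\tilde y^*=(y_1^*,\dots,y_m^* )$ of $h$ exists and $\sup\{\|y_i^{(k)}-y_i^*\|:k\ge0\}<\infty$ for all $i\in\{1,\dots,m-1\}$. 2. If (CQ2) holds, then the iterates $\tilde y^{(k)}=(y_1^{(k)},\dots,y_{m+1}^{(k)})$ of the extended Dykstra's algorithm are bounded. Moreover, an accumulation point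 exists and is a minimizer of $\bar h$; and a minimizer $\tilde y^*=(y_1^*,\dots,y_m^* )$ of $h$ exists such that, with $y_{m+1}^*:=0$, $\sup\{\|y_i^{(k)}-y_i^*\|:k\ge0\}<\infty$ for all $i\in\{1,\dots,m+1\}$. 3. If $N_{C_i}(x^* )$ does not contain a line for every $i\in\{1,\dots,m\}$ (i.e., the cones $N_{C_i}(x^* )$ are pointed), then (CQ1) and (CQ2) are equivalent.
   Context: For a nonempty closed convex set $D\subset\mathbb{R}^n$: $P_D$ is the projection onto $D$; $N_D(x)=\{v:\langle v,c-x\rangle\le0\ \forall c\in D\}$ is the normal cone at $x\in D$; $\delta^*(y,D)=\sup_{x\in D}\langle y,x\rangle\in(-\infty,+\infty]$ is the support function. Dykstra's algorithm (with warmstart): choose arbitrary $y_1^{(0)},\dots,y_m^{(0)}\in X$ and set $x_m^{(0)}=d-\sum_{i=1}^m y_i^{(0)}$. For $k=1,2,\dots$: set $x_0^{(k)}=x_m^{(k-1)}$; for $i=1,\dots,m$ in order set $z_i^{(k)}=x_{i-1}^{(k)}+y_i^{(k-1)}$, $x_i^{(k)}=P_{C_i}(z_i^{(k)})$, $y_i^{(k)}=z_i^{(k)}-x_i^{(k)}$. Extended Dykstra's algorithm: choose arbitrary $y_1^{(0)},\dots,y_m^{(0)}\in X$, and set $y_{m+1}^{(0)}=0$, $H_{m+1}^0=X$, $x_{m+1}^{(0)}=d-\sum_{i=1}^{m+1}y_i^{(0)}$. For $k=1,2,\dots$: - Set $x_0^{(k)}=x_{m+1}^{(k-1)}$. - For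 $i=1,\dots,m$ in order: $z_i^{(k)}=x_{i-1}^{(k)}+y_i^{(k-1)}$, $x_i^{(k)}=P_{C_i}(z_i^{(k)})$, $y_i^{(k)}=z_i^{(k)}-x_i^{(k)}$. - Choose any closed convex set $C_{m+1}^k\subset X$ with $C\subset C_{m+1}^k\subset H_{m+1}^{k-1}$. - Set $z_{m+1}^{(k)}=x_m^{(k)}+y_{m+1}^{(k-1)}$, $x_{m+1}^{(k)}=P_{C_{m+1}^k}(z_{m+1}^{(k)})$, $y_{m+1}^{(k)}=z_{m+1}^{(k)}-x_{m+1}^{(k)}$. - Set $H_{m+1}^k=\{x\in X:\langle y_{m+1}^{(k)},x-x_{m+1}^{(k)}\rangle\le 0\}$. *)

theory Defs
  imports "HOL-Analysis.Analysis"
begin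

text \<open>
  Indices are natural numbers as in the usual notation: \<open>C i\<close> is $C_i$, \<open>y k i\<close> is $y_i^{(k)}$, and
  likewise for \<open>x\<close> and \<open>z\<close>.  A point of $X^m$ is a function \<open>nat \<Rightarrow> 'a\<close> of which only the values
  at \<open>1, \<dots>, m\<close> matter.  The projection $P_D$ is the library's \<^const>\<open>closest_point\<close>.
\<close>

definition normal_cone :: "'a::euclidean_space set \<Rightarrow> 'a \<Rightarrow> 'a set" where
  "normal_cone D x = {v. \<forall>c\<in>D. v \<bullet> (c - x) \<le> 0}"

definition support_fun :: "'a::euclidean_space \<Rightarrow> 'a set \<Rightarrow> ereal" where
  "support_fun y D = (SUP x\<in>D. ereal (y \<bullet> x))"

definition contains_line :: "'a::euclidean_space set \<Rightarrow> bool" where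
  "contains_line S \<longleftrightarrow> (\<exists>a u. u \<noteq> 0 \<and> range (\<lambda>t::real. a + t *\<^sub>R u) \<subseteq> S)"

definition CQ1 :: "nat \<Rightarrow> (nat \<Rightarrow> 'a::euclidean_space set) \<Rightarrow> 'a \<Rightarrow> bool" where
  "CQ1 m C xs \<longleftrightarrow>
     (\<forall>v. (\<Sum>i=1..m. v i) = 0 \<and> (\<forall>i\<in>{1..m}. v i \<in> normal_cone (C i) xs)
        \<longrightarrow> (\<forall>i\<in>{1..m}. v i = 0))"

definition CQ2 :: "nat \<Rightarrow> (nat \<Rightarrow> 'a::euclidean_space set) \<Rightarrow> 'a \<Rightarrow> bool" where
  "CQ2 m C xs \<longleftrightarrow>
     (\<forall>v. (\<Sum>i=1..m+1. v i) = 0 \<and> v (m+1) \<in> normal_cone (\<Inter>i\<in>{1..m}. C i) xs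
            \<and> (\<forall>i\<in>{1..m}. v i \<in> normal_cone (C i) xs)
        \<longrightarrow> (\<forall>i\<in>{1..m+1}. v i = 0))"

definition h_dual :: "nat \<Rightarrow> (nat \<Rightarrow> 'a::euclidean_space set) \<Rightarrow> 'a \<Rightarrow> (nat \<Rightarrow> 'a) \<Rightarrow> ereal" where
  "h_dual m C d y =
     ereal (1/2 * (norm (d - (\<Sum>i=1..m. y i)))\<^sup>2) + (\<Sum>i=1..m. support_fun (y i) (C i))"

definition hbar_dual :: "nat \<Rightarrow> (nat \<Rightarrow> 'a::euclidean_space set) \<Rightarrow> 'a \<Rightarrow> (nat \<Rightarrow> 'a) \<Rightarrow> ereal" where
  "hbar_dual m C d y =
     ereal (1/2 * (norm (d - (\<Sum>i=1..m+1. y i)))\<^sup>2) + (\<Sum>i=1..m. support_fun (y i) (C i))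
       + support_fun (y (m+1)) (\<Inter>i\<in>{1..m}. C i)"

definition minimizer :: "((nat \<Rightarrow> 'a) \<Rightarrow> ereal) \<Rightarrow> (nat \<Rightarrow> 'a) \<Rightarrow> bool" where
  "minimizer f a \<longleftrightarrow> (\<forall>y. f a \<le> f y)"

text \<open>The Euclidean product norm on $X^p$.\<close>

definition prod_norm :: "nat \<Rightarrow> (nat \<Rightarrow> 'a::euclidean_space) \<Rightarrow> real" where
  "prod_norm p y = L2_set (\<lambda>i. norm (y i)) {1..p}"

definition bounded_seq :: "nat \<Rightarrow> (nat \<Rightarrow> nat \<Rightarrow> 'a::euclidean_space) \<Rightarrow> bool" where
  "bounded_seq p y \<longleftrightarrow> (\<exists>B. \<forall>k. prod_norm p (y k) \<le> B)"

definition accumulation_point ::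
    "nat \<Rightarrow> (nat \<Rightarrow> nat \<Rightarrow> 'a::euclidean_space) \<Rightarrow> (nat \<Rightarrow> 'a) \<Rightarrow> bool" where
  "accumulation_point p y a \<longleftrightarrow>
     (\<exists>r. strict_mono r \<and> (\<lambda>j. prod_norm p (\<lambda>i. y (r j) i - a i)) \<longlonglongrightarrow> 0)"

text \<open>
  The algorithms are relations on whole runs.  No condition is put on \<open>y 0 i\<close> for \<open>1 \<le> i \<le> m\<close>
  (arbitrary warmstart), and entries with no counterpart in the algorithm, such as \<open>z 0 i\<close>
  or \<open>x 0 0\<close>, are unconstrained and never used.
\<close>

definition dykstra ::
    "nat \<Rightarrow> (nat \<Rightarrow> 'a::euclidean_space set) \<Rightarrow> 'a \<Rightarrow>
     (nat \<Rightarrow> nat \<Rightarrow> 'a) \<Rightarrow> (nat \<Rightarrow> nat \<Rightarrow> 'a) \<Rightarrow> (nat \<Rightarrow> nat \<Rightarrow> 'a) \<Rightarrow> bool" where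
  "dykstra m C d x y z \<longleftrightarrow>
     x 0 m = d - (\<Sum>i=1..m. y 0 i) \<and>
     (\<forall>k\<ge>1.
        x k 0 = x (k - 1) m \<and>
        (\<forall>i\<in>{1..m}.
           z k i = x k (i - 1) + y (k - 1) i \<and>
           x k i = closest_point (C i) (z k i) \<and>
           y k i = z k i - x k i))"

text \<open>\<open>D k\<close> is the set $C_{m+1}^k$ chosen in iteration \<open>k\<close>, and \<open>H k\<close> is $H_{m+1}^k$.\<close>

definition extended_dykstra ::
    "nat \<Rightarrow> (nat \<Rightarrow> 'a::euclidean_space set) \<Rightarrow> 'a \<Rightarrow>
     (nat \<Rightarrow> nat \<Rightarrow> 'a) \<Rightarrow> (nat \<Rightarrow> nat \<Rightarrow> 'a) \<Rightarrow> (nat \<Rightarrow> nat \<Rightarrow> 'a) \<Rightarrow>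
     (nat \<Rightarrow> 'a set) \<Rightarrow> (nat \<Rightarrow> 'a set) \<Rightarrow> bool" where
  "extended_dykstra m C d x y z D H \<longleftrightarrow>
     y 0 (m+1) = 0 \<and> H 0 = UNIV \<and> x 0 (m+1) = d - (\<Sum>i=1..m+1. y 0 i) \<and>
     (\<forall>k\<ge>1.
        x k 0 = x (k - 1) (m+1) \<and>
        (\<forall>i\<in>{1..m}.
           z k i = x k (i - 1) + y (k - 1) i \<and>
           x k i = closest_point (C i) (z k i) \<and>
           y k i = z k i - x k i) \<and>
        closed (D k) \<and> convex (D k) \<and> (\<Inter>i\<in>{1..m}. C i) \<subseteq> D k \<and> D k \<subseteq> H (k - 1) \<and>
        z k (m+1) = x k m + y (k - 1) (m+1) \<and>
        x k (m+1) = closest_point (D k) (z k (m+1)) \<and>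
        y k (m+1) = z k (m+1) - x k (m+1) \<and>
        H k = {u. y k (m+1) \<bullet> (u - x k (m+1)) \<le> 0})"

end

theory Submission imports Defs begin

text \<open>
  Both algorithms are runs of one scheme: cyclically, each of \<open>p\<close> sets moves the current point
  from \<open>x\<^sub>i\<^sub>-\<^sub>1\<close> to \<open>x\<^sub>i\<close> and adds \<open>x\<^sub>i\<^sub>-\<^sub>1 - x\<^sub>i\<close> to its correction \<open>y\<^sub>i\<close>, so that the point plus the
  sum of all corrections stays equal to \<open>d\<close>, and \<open>y\<^sub>i\<close> is normal at \<open>x\<^sub>i\<close> to a fixed set \<open>E i\<close>.  For the
  extended algorithm the last fixed set is the intersection \<open>C\<close>, although the projection is onto
  varying larger sets.  The locale \<open>cyclic_correction_run\<close> records what is common to both.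

  Convergence is the argument of Boyle and Dykstra.  The dual objective, with the support functions
  of the sets last projected onto, exceeds its optimal value by the gap
  \<open>1/2 |x - x*|\<^sup>2 + (\<Sum>i. y\<^sub>i \<bullet> (x\<^sub>i - x*))\<close>.  From the first cycle on it is nonnegative, and in each cycle it drops by at
  least half the sum of the squared displacements.  Hence the lengths of the cycles are square
  summable, while the corrections grow at most like the partial sums of these lengths; an
  elementary fact about series (\<open>square_summable_times_partial_sums\<close>) makes the product of the two
  vanish along a subsequence.  Along that subsequence the iterates converge to \<open>x*\<close> and the gap
  tends to zero (\<open>gap_subsequence\<close>), and monotonicity extends this to the whole sequence.

  Now suppose the corrections were unbounded.  Dividing them by their total size and passing to a
  limit gives elements of the cones \<open>N\<close> of the sets \<open>E i\<close> at \<open>x*\<close>; their sum is zero, because the sum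
  of the corrections is \<open>d - x\<close> and stays bounded, but they are not all zero.  This is what the
  constraint qualification excludes (\<open>corrections_bounded\<close>).  An accumulation point \<open>a\<close> then consists of
  normal vectors \<open>a\<^sub>i\<close> at \<open>x*\<close> with sum \<open>d - x*\<close>, and weak duality shows that such a multiplier is a
  minimizer of the dual (\<open>multiplier_minimizes_h_dual\<close>).

  Running Dykstra's algorithm from \<open>x* + v\<close> for a normal vector \<open>v\<close> of \<open>C\<close> at \<open>x*\<close> decomposes \<open>v\<close> into
  normals of the \<open>C i\<close> (\<open>normal_cone_inter_decomposition\<close>).  So the algorithm itself supplies the sum
  rule for normal cones under (CQ1).  This yields the minimizers of \<open>h\<close>, and it reduces (CQ2) to
  (CQ1) when the cones are pointed: replacing the last vector by its decomposition turns a relation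
  for (CQ2) into one for (CQ1).
\<close>

section \<open>Sequences\<close>

lemma finite_family_convergent_subsequence:
  fixes w :: "nat \<Rightarrow> nat \<Rightarrow> 'a::euclidean_space"
  assumes "finite I" and "\<And>i. i \<in> I \<Longrightarrow> bounded (range (\<lambda>k. w k i))"
  shows "\<exists>l r. strict_mono r \<and> (\<forall>i\<in>I. (\<lambda>k. w (r k) i) \<longlonglongrightarrow> l i)"
  using assms
proof (induction I rule: finite_induct)
  case empty
  show ?case using strict_mono_id by auto
next
  case (insert a I)
  then obtain l r where r: "strict_mono r" and l: "\<forall>i\<in>I. (\<lambda>k. w (r k) i) \<longlonglongrightarrow> l i"
    by auto
  have "bounded (range (\<lambda>k. w (r k) a))"
    by (rule bounded_subset[OF insert.prems[of a]]) auto
  then obtain b q where q: "strict_mono q" and b: "((\<lambda>k. w (r k) a) \<circ> q) \<longlonglongrightarrow> b"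
    using bounded_imp_convergent_subsequence by blast
  have "(\<lambda>k. w ((r \<circ> q) k) i) \<longlonglongrightarrow> (l(a := b)) i" if "i \<in> insert a I" for i
  proof (cases "i = a")
    case True
    then show ?thesis using b by (simp add: o_def)
  next
    case False
    with that l have "(\<lambda>k. w (r k) i) \<longlonglongrightarrow> l i" by auto
    from LIMSEQ_subseq_LIMSEQ[OF this q] False show ?thesis by (simp add: o_def)
  qed
  with strict_mono_o[OF r q] show ?case by blast
qed

lemma subsequence_to_zero:
  fixes f :: "nat \<Rightarrow> real"
  assumes nonneg: "\<And>k. 0 \<le> f k" and small: "\<And>e N. 0 < e \<Longrightarrow> \<exists>k\<ge>N. f k < e"
  shows "\<exists>r. strict_mono r \<and> (\<lambda>j. f (r j)) \<longlonglongrightarrow> 0"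
proof -
  have "\<exists>r. \<forall>n. f (r n) < inverse (real (Suc n)) \<and> r n < r (Suc n)"
  proof (rule dependent_nat_choice)
    show "\<exists>k. f k < inverse (real (Suc 0))"
      using small[of 1 0] by auto
    show "\<exists>l. f l < inverse (real (Suc (Suc n))) \<and> k < l" for k n
      using small[of "inverse (real (Suc (Suc n)))" "Suc k"] by (auto simp: Suc_le_eq)
  qed
  then obtain r where r: "\<And>n. f (r n) < inverse (real (Suc n))" "\<And>n. r n < r (Suc n)"
    by blast
  have "(\<lambda>j. f (r j)) \<longlonglongrightarrow> 0"
    by (rule tendsto_sandwich[OF _ _ tendsto_const LIMSEQ_inverse_real_of_nat])
       (use nonneg r(1) in \<open>auto intro!: always_eventually less_imp_le\<close>)
  with r(2) show ?thesis by (auto simp: strict_mono_Suc_iff)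
qed

text \<open>
  By Cauchy-Schwarz the partial sums of a square-summable sequence grow at most like \<open>sqrt k\<close>.
  If the product stayed above \<open>e > 0\<close>, then \<open>(a k)\<^sup>2\<close> would be at least a multiple of \<open>1 / k\<close>,
  which is not summable.
\<close>

lemma square_summable_times_partial_sums:
  fixes a :: "nat \<Rightarrow> real"
  assumes a: "\<And>k. 0 \<le> a k" and sq: "summable (\<lambda>k. (a k)\<^sup>2)" and B: "0 \<le> B"
  shows "\<exists>r. strict_mono r \<and> (\<lambda>j. a (r j) * (B + sum a {..r j})) \<longlonglongrightarrow> 0"
proof (rule subsequence_to_zero)
  show "0 \<le> a k * (B + sum a {..k})" for k
    using a B by (simp add: sum_nonneg)
  show "\<exists>k\<ge>N. a k * (B + sum a {..k}) < e" if e: "0 < e" for e N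
  proof (rule ccontr)
    assume "\<not> ?thesis"
    then have ge: "e \<le> a k * (B + sum a {..k})" if "N \<le> k" for k
      using that by (auto simp: not_less)
    define A where "A = 2 * (B\<^sup>2 + (\<Sum>k. (a k)\<^sup>2)) + 1"
    have A: "0 < A" 
      using suminf_nonneg[OF sq] by (simp add: A_def add_nonneg_pos)
    have growth: "(B + sum a {..k})\<^sup>2 \<le> A * real (Suc k)" for k
    proof -
      have "(sum a {..k})\<^sup>2 \<le> (\<Sum>i\<le>k. (a i)\<^sup>2) * (\<Sum>i\<le>k. 1\<^sup>2)"
        using Cauchy_Schwarz_ineq_sum[of a "\<lambda>_. 1" "{..k}"] by simp
      also have "\<dots> \<le> (\<Sum>k. (a k)\<^sup>2) * real (Suc k)"
        using sum_le_suminf[OF sq, of "{..k}"] by (simp add: mult_right_mono)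
      finally have "(sum a {..k})\<^sup>2 \<le> (\<Sum>k. (a k)\<^sup>2) * real (Suc k)" .
      moreover have "B\<^sup>2 \<le> B\<^sup>2 * real (Suc k)"
        using mult_left_mono[of 1 "real (Suc k)" "B\<^sup>2"] by simp
      ultimately have "2 * B\<^sup>2 + 2 * (sum a {..k})\<^sup>2
          \<le> 2 * (B\<^sup>2 * real (Suc k)) + 2 * ((\<Sum>k. (a k)\<^sup>2) * real (Suc k))"
        by (intro add_mono mult_left_mono) auto
      moreover have "(B + sum a {..k})\<^sup>2 \<le> 2 * B\<^sup>2 + 2 * (sum a {..k})\<^sup>2"
        using sum_squares_bound[of B "sum a {..k}"] by (simp add: power2_sum)
      ultimately have "(B + sum a {..k})\<^sup>2
          \<le> 2 * (B\<^sup>2 * real (Suc k)) + 2 * ((\<Sum>k. (a k)\<^sup>2) * real (Suc k))"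
        by (rule order_trans[rotated])
      also have "\<dots> = 2 * (B\<^sup>2 + (\<Sum>k. (a k)\<^sup>2)) * real (Suc k)"
        by (simp only: distrib_right distrib_left mult.assoc)
      also have "\<dots> \<le> A * real (Suc k)"
        by (rule mult_right_mono) (auto simp: A_def)
      finally show ?thesis .
    qed
    have lower: "e\<^sup>2 / A * inverse (real (Suc k)) \<le> (a k)\<^sup>2" if "N \<le> k" for k
    proof -
      have "e\<^sup>2 \<le> (a k * (B + sum a {..k}))\<^sup>2"
        using ge[OF that] e by (intro power_mono) auto
      also have "\<dots> \<le> (a k)\<^sup>2 * (A * real (Suc k))"
        unfolding power_mult_distrib by (rule mult_left_mono[OF growth]) simp
      finally have "e\<^sup>2 / (A * real (Suc k)) \<le> (a k)\<^sup>2"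
        using A by (simp add: pos_divide_le_eq)
      then show ?thesis by (simp add: divide_inverse mult.assoc)
    qed
    have "summable (\<lambda>k. e\<^sup>2 / A * inverse (real (Suc k)))"
      by (rule summable_comparison_test'[OF sq, of N]) (use lower A in auto)
    then have "summable (\<lambda>k. inverse (real (Suc k)))"
      using e A by (simp add: summable_cmult_iff)
    then show False
      using summable_Suc_iff[of "\<lambda>k. inverse (real k)"] not_summable_harmonic[where 'a=real] by simp
  qed
qed

lemma sum_diff_telescope_from_1:
  fixes f :: "nat \<Rightarrow> 'b::ab_group_add"
  shows "(\<Sum>i=1..p. f (i - 1) - f i) = f 0 - f p"
  by (induction p) (auto simp: algebra_simps)

section \<open>Cyclic runs with corrections\<close>

text \<open>
  The sets \<open>E 1, \<dots>, E m\<close> are the ones whose intersection is projected onto, and their projections are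
  feasible; the indices from \<open>m + 1\<close> to \<open>p\<close> stand for sets \<open>E i\<close> containing that intersection, onto which
  the steps need not project.  The assumption \<open>descent\<close> says that the next point of index \<open>i\<close> lies in the
  supporting halfspace at the previous one; it is the only link between the sets projected onto in
  consecutive cycles, and this is what allows them to vary.  Normality and feasibility start at
  cycle 1, as the initial corrections are arbitrary.
\<close>

locale cyclic_correction_run =
  fixes m p :: nat and E :: "nat \<Rightarrow> 'a::euclidean_space set" and d xs :: 'a
    and x y :: "nat \<Rightarrow> nat \<Rightarrow> 'a"
  assumes sets_closed: "\<And>i. i \<in> {1..m} \<Longrightarrow> closed (E i)"
    and m_le_p: "m \<le> p"
    and inter_subset: "\<And>i. i \<in> {1..p} \<Longrightarrow> (\<Inter>i\<in>{1..m}. E i) \<subseteq> E i"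
    and xs_in: "xs \<in> (\<Inter>i\<in>{1..m}. E i)"
    and xs_proj: "\<And>c. c \<in> (\<Inter>i\<in>{1..m}. E i) \<Longrightarrow> (d - xs) \<bullet> (c - xs) \<le> 0"
    and start: "x 0 p = d - (\<Sum>i=1..p. y 0 i)"
    and cyclic: "\<And>k. x (Suc k) 0 = x k p"
    and correction: "\<And>k i. i \<in> {1..p} \<Longrightarrow> y (Suc k) i = y k i + (x (Suc k) (i - 1) - x (Suc k) i)"
    and normal: "\<And>k i c. i \<in> {1..p} \<Longrightarrow> c \<in> E i \<Longrightarrow> y (Suc k) i \<bullet> (c - x (Suc k) i) \<le> 0"
    and descent: "\<And>k i. i \<in> {1..p} \<Longrightarrow> y (Suc k) i \<bullet> (x (Suc (Suc k)) i - x (Suc k) i) \<le> 0"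
    and feasible: "\<And>k i. i \<in> {1..m} \<Longrightarrow> x (Suc k) i \<in> E i"
begin

definition step_length :: "nat \<Rightarrow> real" where
  "step_length k = (\<Sum>i=1..p. norm (x k (i - 1) - x k i))"

text \<open>
  The optimality gap of the dual problem at \<open>y k\<close>: the support function at \<open>y k i\<close> of the set whose
  projection produced \<open>x k i\<close> is \<open>y k i \<bullet> x k i\<close>, and subtracting the optimal dual value
  \<open>1/2 |d|\<^sup>2 - 1/2 |d - xs|\<^sup>2\<close> and completing the square gives this expression.  The support function
  of a smaller \<open>E i\<close> may be less than that; then the gap is an upper bound.
\<close>

definition gap :: "nat \<Rightarrow> real" where
  "gap k = 1/2 * (norm (x k p - xs))\<^sup>2 + (\<Sum>i=1..p. y k i \<bullet> (x k i - xs))"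

lemma xs_in_E: "i \<in> {1..p} \<Longrightarrow> xs \<in> E i"
  using inter_subset xs_in by blast

lemma sum_corrections: "(\<Sum>i=1..p. y k i) = d - x k p"
proof (induction k)
  case 0
  then show ?case using start by simp
next
  case (Suc k)
  have "(\<Sum>i=1..p. y (Suc k) i)
      = (\<Sum>i=1..p. y k i) + (\<Sum>i=1..p. x (Suc k) (i - 1) - x (Suc k) i)"
    by (simp add: correction sum.distrib)
  then show ?case unfolding sum_diff_telescope_from_1[of "x (Suc k)"] by (simp only: Suc cyclic) simp
qed

lemma step_length_nonneg: "0 \<le> step_length k"
  by (simp add: step_length_def sum_nonneg)

lemma normal_terms_nonneg: "i \<in> {1..p} \<Longrightarrow> 0 \<le> y (Suc k) i \<bullet> (x (Suc k) i - xs)"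
  using normal[OF _ xs_in_E, of i k] by (simp add: inner_diff_right)

lemma normal_sum_nonneg: "0 \<le> (\<Sum>i=1..p. y (Suc k) i \<bullet> (x (Suc k) i - xs))"
  by (rule sum_nonneg) (rule normal_terms_nonneg)

lemma half_dist_le_gap: "1/2 * (norm (x (Suc k) p - xs))\<^sup>2 \<le> gap (Suc k)"
  unfolding gap_def using normal_sum_nonneg by simp

lemma gap_nonneg: "0 \<le> gap (Suc k)"
  by (rule order_trans[OF _ half_dist_le_gap]) simp

text \<open>
  Replacing one correction changes the point and that correction by opposite displacements.
  Expanding the squares, the gap changes by minus half the squared displacement plus the inner
  product that \<open>descent\<close> bounds by zero.  Summing over the cycle telescopes the squared distances.
\<close>

lemma gap_decrease:
  "gap (Suc (Suc k)) + 1/2 * (\<Sum>i=1..p. (norm (x (Suc (Suc k)) (i - 1) - x (Suc (Suc k)) i))\<^sup>2)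
    \<le> gap (Suc k)"
proof -
  let ?u = "\<lambda>i. x (Suc (Suc k)) i - xs"
  have each: "y (Suc (Suc k)) i \<bullet> ?u i + 1/2 * (norm (x (Suc (Suc k)) (i - 1) - x (Suc (Suc k)) i))\<^sup>2
      \<le> y (Suc k) i \<bullet> (x (Suc k) i - xs) + 1/2 * ((norm (?u (i - 1)))\<^sup>2 - (norm (?u i))\<^sup>2)"
    if i: "i \<in> {1..p}" for i
    using descent[OF i, of k]
    unfolding correction[OF i, of "Suc k"] power2_norm_eq_inner
    by (simp add: inner_simps inner_commute algebra_simps)
  have tele: "(\<Sum>i=1..p. (norm (?u (i - 1)))\<^sup>2 - (norm (?u i))\<^sup>2)
      = (norm (x (Suc k) p - xs))\<^sup>2 - (norm (?u p))\<^sup>2"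
    using sum_diff_telescope_from_1[of "\<lambda>i. (norm (?u i))\<^sup>2" p] by (simp add: cyclic)
  have "(\<Sum>i=1..p. y (Suc (Suc k)) i \<bullet> ?u i)
        + 1/2 * (\<Sum>i=1..p. (norm (x (Suc (Suc k)) (i - 1) - x (Suc (Suc k)) i))\<^sup>2)
      \<le> (\<Sum>i=1..p. y (Suc k) i \<bullet> (x (Suc k) i - xs))
        + 1/2 * (\<Sum>i=1..p. (norm (?u (i - 1)))\<^sup>2 - (norm (?u i))\<^sup>2)"
    unfolding sum_distrib_left sum.distrib[symmetric] by (rule sum_mono) (rule each)
  then show ?thesis unfolding tele gap_def by (simp add: diff_divide_distrib)
qed

lemma gap_antimono: "1 \<le> k \<Longrightarrow> k \<le> l \<Longrightarrow> gap l \<le> gap k"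
proof (rotate_tac, induction l rule: dec_induct)
  case (step n)
  then obtain n' where "n = Suc n'" by (cases n) auto
  moreover have "0 \<le> (\<Sum>i=1..p. (norm (x (Suc n) (i - 1) - x (Suc n) i))\<^sup>2)"
    by (simp add: sum_nonneg)
  ultimately show ?case using gap_decrease[of n'] step by simp
qed simp

lemma step_length_square_summable: "summable (\<lambda>k. (step_length k)\<^sup>2)"
proof -
  define q where "q k = (\<Sum>i=1..p. (norm (x (Suc (Suc k)) (i - 1) - x (Suc (Suc k)) i))\<^sup>2)" for k
  have "(\<Sum>k<n. q k) \<le> 2 * (gap 1 - gap (Suc n))" for n
  proof (induction n)
    case (Suc n)
    then show ?case using gap_decrease[of n] unfolding q_def[symmetric] by simp
  qed simp
  then have "(\<Sum>k<n. q k) \<le> 2 * gap 1" for n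
    using gap_nonneg[of n] by (smt (verit))
  then have "summable q"
    by (intro bounded_imp_summable[of q "2 * gap 1"])
       (simp_all only: lessThan_Suc_atMost[symmetric] q_def sum_nonneg zero_le_power2)
  then have sq: "summable (\<lambda>k. real p * q k)" by (rule summable_mult)
  have "(step_length (Suc (Suc k)))\<^sup>2 \<le> real p * q k" for k
    unfolding step_length_def q_def
    using Cauchy_Schwarz_ineq_sum[of "\<lambda>_. 1" "\<lambda>i. norm (x (Suc (Suc k)) (i - 1) - x (Suc (Suc k)) i)" "{1..p}"]
    by simp
  then have "summable (\<lambda>k. (step_length (Suc (Suc k)))\<^sup>2)"
    by (intro summable_comparison_test'[OF sq, of 0]) auto
  then show ?thesis
    using summable_Suc_iff[of "\<lambda>k. (step_length (Suc k))\<^sup>2"]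
      summable_Suc_iff[of "\<lambda>k. (step_length k)\<^sup>2"] by simp
qed

lemma dist_within_cycle:
  assumes "i \<le> p"
  shows "norm (x k i - x k p) \<le> step_length k"
proof -
  have "x k i - x k p = (\<Sum>j=Suc i..p. x k (j - 1) - x k j)"
    using assms by (induction p rule: dec_induct) (auto simp: algebra_simps)
  also have "norm \<dots> \<le> (\<Sum>j=Suc i..p. norm (x k (j - 1) - x k j))"
    by (rule norm_sum)
  also have "\<dots> \<le> step_length k"
    unfolding step_length_def by (rule sum_mono2) auto
  finally show ?thesis .
qed

text \<open>
  A correction is its initial value plus all displacements made at its index.
\<close>

lemma norm_correction_le:
  assumes i: "i \<in> {1..p}"
  shows "norm (y k i) \<le> (\<Sum>i=1..p. norm (y 0 i)) + sum step_length {..k}"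
proof (induction k)
  case 0
  have "norm (y 0 i) \<le> (\<Sum>i=1..p. norm (y 0 i))"
    by (rule member_le_sum[OF i]) auto
  then show ?case using step_length_nonneg[of 0] by simp
next
  case (Suc k)
  have "norm (x (Suc k) (i - 1) - x (Suc k) i) \<le> step_length (Suc k)"
    unfolding step_length_def
    by (rule member_le_sum[OF i, of "\<lambda>i. norm (x (Suc k) (i - 1) - x (Suc k) i)"]) auto
  then show ?case
    using norm_triangle_ineq[of "y k i" "x (Suc k) (i - 1) - x (Suc k) i"] Suc
    unfolding correction[OF i] by simp
qed

text \<open>
  Replacing \<open>x k i\<close> by the last point of the cycle leaves the sum of all corrections, which is known,
  and an error that is small when the cycle is short compared with the size of the corrections.
\<close>

lemma sum_inner_split:
  "(\<Sum>i=1..p. y k i \<bullet> (x k i - xs))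
    = (\<Sum>i=1..p. y k i \<bullet> (x k i - x k p)) + (d - x k p) \<bullet> (x k p - xs)"
  unfolding sum_corrections[symmetric] inner_sum_left sum.distrib[symmetric]
  by (simp add: inner_diff_right)

lemma step_length_LIMSEQ: "step_length \<longlonglongrightarrow> 0"
  using tendsto_real_sqrt[OF summable_LIMSEQ_zero[OF step_length_square_summable]]
  by (simp add: step_length_nonneg)

text \<open>
  Choose a subsequence along which cycle length times size of the corrections tends to zero, and
  then one along which the iterates converge, to \<open>xb\<close>.  The limit is feasible.  Nonnegativity of the
  normal terms gives \<open>(d - xb) \<bullet> (xb - xs) \<ge> 0\<close> in the limit, which together with the variational
  inequality of the projection forces \<open>xb = xs\<close>.  The gap then vanishes in the limit as well.
\<close>

lemma gap_subsequence:
  "\<exists>r. strict_mono r \<and> (\<lambda>j. gap (r j)) \<longlonglongrightarrow> 0"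
proof -
  define B where "B = (\<Sum>i=1..p. norm (y 0 i))"
  define W where "W k = step_length k * (B + sum step_length {..k})" for k
  define err where "err k = (\<Sum>i=1..p. y k i \<bullet> (x k i - x k p))" for k
  obtain r where r: "strict_mono r" and W: "(W \<circ> r) \<longlonglongrightarrow> 0"
    using square_summable_times_partial_sums[OF step_length_nonneg step_length_square_summable, of B]
    by (auto simp: B_def W_def o_def sum_nonneg)
  \<comment> \<open>The shift skips cycle 0, where the starting data satisfy no normality or feasibility.\<close>
  define r1 where "r1 = r \<circ> Suc"
  have r1: "strict_mono r1"
    using r by (auto simp: strict_mono_Suc_iff r1_def)
  have pos: "1 \<le> r1 j" for j
    using strict_monoD[OF r, of 0 "Suc j"] unfolding r1_def by simp
  have W1: "(W \<circ> r1) \<longlonglongrightarrow> 0"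
    using LIMSEQ_Suc[OF W] by (simp add: r1_def o_def)
  have "norm (x (r1 j) p - xs) \<le> sqrt (2 * gap 1)" for j
  proof (rule real_le_rsqrt)
    show "(norm (x (r1 j) p - xs))\<^sup>2 \<le> 2 * gap 1"
      using half_dist_le_gap[of "r1 j - 1"] gap_antimono[OF order_refl pos[of j]] pos[of j] by simp
  qed
  then have "bounded (range (\<lambda>j. x (r1 j) p))"
    by (intro bounded_subset[OF bounded_cball[of xs "sqrt (2 * gap 1)"]])
       (auto simp: dist_norm norm_minus_commute)
  then obtain xb q where q: "strict_mono q" and xb: "((\<lambda>j. x (r1 j) p) \<circ> q) \<longlonglongrightarrow> xb"
    using bounded_imp_convergent_subsequence by blast
  define r2 where "r2 = r1 \<circ> q"
  have r2: "strict_mono r2" unfolding r2_def by (rule strict_mono_o[OF r1 q])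
  have pos2: "1 \<le> r2 j" for j using pos by (simp add: r2_def)
  have xp: "(\<lambda>j. x (r2 j) p) \<longlonglongrightarrow> xb" using xb by (simp add: r2_def o_def)
  have xi: "(\<lambda>j. x (r2 j) i) \<longlonglongrightarrow> xb" if "i \<le> p" for i
  proof -
    have "(\<lambda>j. x (r2 j) i - x (r2 j) p) \<longlonglongrightarrow> 0"
    proof (rule Lim_null_comparison)
      show "(\<lambda>j. step_length (r2 j)) \<longlonglongrightarrow> 0"
        using LIMSEQ_subseq_LIMSEQ[OF step_length_LIMSEQ r2] by (simp add: o_def)
    qed (use dist_within_cycle[OF that] in auto)
    from tendsto_add[OF this xp] show ?thesis by simp
  qed
  have "xb \<in> E i" if i: "i \<in> {1..m}" for i
  proof (rule closed_sequentially[OF sets_closed[OF i]])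
    show "x (r2 j) i \<in> E i" for j
      using feasible[OF i, of "r2 j - 1"] pos2[of j] by simp
    show "(\<lambda>j. x (r2 j) i) \<longlonglongrightarrow> xb" using xi i m_le_p by simp
  qed
  then have "(d - xs) \<bullet> (xb - xs) \<le> 0" by (intro xs_proj) auto
  have err: "(\<lambda>j. err (r2 j)) \<longlonglongrightarrow> 0"
  proof (rule Lim_null_comparison)
    show "(\<lambda>j. real p * W (r2 j)) \<longlonglongrightarrow> 0"
      using tendsto_mult_right_zero[OF LIMSEQ_subseq_LIMSEQ[OF W1 q], of "real p"]
      by (simp add: r2_def o_def)
    have "norm (err k) \<le> real p * W k" for k
    proof -
      have "norm (y k i \<bullet> (x k i - x k p)) \<le> W k" if i: "i \<in> {1..p}" for i
      proof -
        have "norm (y k i \<bullet> (x k i - x k p)) \<le> norm (x k i - x k p) * norm (y k i)"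
          using Cauchy_Schwarz_ineq2[of "y k i" "x k i - x k p"] by (simp add: mult.commute)
        also have "\<dots> \<le> W k"
          unfolding W_def B_def
          by (rule mult_mono) (use i dist_within_cycle norm_correction_le step_length_nonneg in auto)
        finally show ?thesis .
      qed
      from sum_norm_le[of "{1..p}", OF this] show ?thesis by (simp add: err_def)
    qed
    then show "\<forall>\<^sub>F j in sequentially. norm (err (r2 j)) \<le> real p * W (r2 j)" by simp
  qed
  have "(\<lambda>j. err (r2 j) + (d - x (r2 j) p) \<bullet> (x (r2 j) p - xs))
      \<longlonglongrightarrow> 0 + (d - xb) \<bullet> (xb - xs)"
    by (intro tendsto_intros err xp)
  then have lim: "(\<lambda>j. err (r2 j) + (d - x (r2 j) p) \<bullet> (x (r2 j) p - xs))
      \<longlonglongrightarrow> (d - xb) \<bullet> (xb - xs)" by simp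
  have "0 \<le> err (r2 j) + (d - x (r2 j) p) \<bullet> (x (r2 j) p - xs)" for j
    using normal_sum_nonneg[of "r2 j - 1"] pos2[of j]
      sum_inner_split[of "r2 j"] by (simp add: err_def)
  then have "0 \<le> (d - xb) \<bullet> (xb - xs)"
    by (intro LIMSEQ_le_const[OF lim]) blast
  with \<open>(d - xs) \<bullet> (xb - xs) \<le> 0\<close> have "(xb - xs) \<bullet> (xb - xs) \<le> 0"
    by (simp add: inner_simps inner_commute)
  from antisym[OF this inner_ge_zero] have "xb = xs" by simp
  have "(\<lambda>j. 1/2 * (norm (x (r2 j) p - xs))\<^sup>2
        + (err (r2 j) + (d - x (r2 j) p) \<bullet> (x (r2 j) p - xs)))
      \<longlonglongrightarrow> 1/2 * (norm (xb - xs))\<^sup>2 + (0 + (d - xb) \<bullet> (xb - xs))"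
    by (intro tendsto_intros xp err)
  then have "(\<lambda>j. gap (r2 j)) \<longlonglongrightarrow> 0"
    unfolding gap_def sum_inner_split err_def \<open>xb = xs\<close> by simp
  with r2 show ?thesis by blast
qed

lemma gap_LIMSEQ: "gap \<longlonglongrightarrow> 0"
proof (rule LIMSEQ_I)
  fix e :: real assume e: "0 < e"
  obtain r where r: "strict_mono r" and lim: "(\<lambda>j. gap (r j)) \<longlonglongrightarrow> 0"
    using gap_subsequence by blast
  obtain N where N: "\<And>j. N \<le> j \<Longrightarrow> norm (gap (r j) - 0) < e"
    using LIMSEQ_D[OF lim e] by blast
  define K where "K = r (Suc N)"
  have K: "1 \<le> K" using seq_suble[OF r, of "Suc N"] by (simp add: K_def)
  have "norm (gap k - 0) < e" if "K \<le> k" for k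
    using N[of "Suc N"] gap_antimono[OF K that] gap_nonneg[of "k - 1"] K that by (simp add: K_def)
  then show "\<exists>K. \<forall>k\<ge>K. norm (gap k - 0) < e" by blast
qed

lemma iterates_converge:
  assumes "i \<le> p"
  shows "(\<lambda>k. x k i) \<longlonglongrightarrow> xs"
proof -
  have "(\<lambda>k. (norm (x (Suc k) p - xs))\<^sup>2) \<longlonglongrightarrow> 0"
  proof (rule Lim_null_comparison)
    show "(\<lambda>k. 2 * gap (Suc k)) \<longlonglongrightarrow> 0"
      using tendsto_mult_right_zero[OF LIMSEQ_Suc[OF gap_LIMSEQ], of 2] by simp
  qed (use half_dist_le_gap in \<open>auto simp: field_simps\<close>)
  from tendsto_real_sqrt[OF this] have "(\<lambda>k. x (Suc k) p - xs) \<longlonglongrightarrow> 0"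
    by (simp add: tendsto_norm_zero_iff)
  then have p: "(\<lambda>k. x k p - xs) \<longlonglongrightarrow> 0" by (rule LIMSEQ_imp_Suc)
  have "(\<lambda>k. x k i - x k p) \<longlonglongrightarrow> 0"
    by (rule Lim_null_comparison[OF _ step_length_LIMSEQ]) (use dist_within_cycle[OF assms] in auto)
  from tendsto_add[OF this p] show ?thesis by (simp add: LIM_zero_iff)
qed

text \<open>
  The normal cone has a closed graph, and the points of tangency converge.  The scaling \<open>t\<close> serves
  two purposes: it is constant for accumulation points, and it normalizes the corrections in the proof
  that they are bounded.
\<close>

lemma scaled_limit_in_normal_cone:
  assumes i: "i \<in> {1..p}" and r: "strict_mono r" and t: "\<And>j. 0 \<le> t j"
    and v: "(\<lambda>j. t j *\<^sub>R y (r j) i) \<longlonglongrightarrow> v"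
  shows "v \<in> normal_cone (E i) xs"
  unfolding normal_cone_def
proof (intro CollectI ballI)
  fix c assume c: "c \<in> E i"
  have "(\<lambda>j. x (r j) i) \<longlonglongrightarrow> xs"
    using LIMSEQ_subseq_LIMSEQ[OF iterates_converge r, of i] i by (simp add: o_def)
  then have lim: "(\<lambda>j. (t j *\<^sub>R y (r j) i) \<bullet> (c - x (r j) i)) \<longlonglongrightarrow> v \<bullet> (c - xs)"
    by (intro tendsto_intros v)
  have "(t j *\<^sub>R y (r j) i) \<bullet> (c - x (r j) i) \<le> 0" if "1 \<le> j" for j
    using normal[OF i c, of "r j - 1"] t[of j] seq_suble[OF r, of j] that
    by (simp add: mult_nonneg_nonpos)
  then show "v \<bullet> (c - xs) \<le> 0"
    by (intro LIMSEQ_le_const2[OF lim]) blast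
qed

lemma limit_is_multiplier:
  assumes r: "strict_mono r" and a: "\<And>i. i \<in> {1..p} \<Longrightarrow> (\<lambda>j. y (r j) i) \<longlonglongrightarrow> a i"
  shows "(\<Sum>i=1..p. a i) = d - xs" and "i \<in> {1..p} \<Longrightarrow> a i \<in> normal_cone (E i) xs"
proof -
  have "(\<lambda>j. \<Sum>i=1..p. y (r j) i) \<longlonglongrightarrow> (\<Sum>i=1..p. a i)"
    by (intro tendsto_sum a)
  moreover have "(\<lambda>j. \<Sum>i=1..p. y (r j) i) \<longlonglongrightarrow> d - xs"
    unfolding sum_corrections
    using LIMSEQ_subseq_LIMSEQ[OF iterates_converge r, of p] by (intro tendsto_intros) (simp add: o_def)
  ultimately show "(\<Sum>i=1..p. a i) = d - xs" by (rule LIMSEQ_unique)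
  show "a i \<in> normal_cone (E i) xs" if "i \<in> {1..p}"
    using scaled_limit_in_normal_cone[OF that r, of "\<lambda>_. 1"] a[OF that] by simp
qed

text \<open>
  Normalized corrections along a subsequence with \<open>N\<close> tending to infinity have a limit that violates
  the constraint qualification.
\<close>

lemma corrections_bounded:
  assumes cq: "CQ1 p E xs"
  shows "\<exists>B. \<forall>k. (\<Sum>i=1..p. norm (y k i)) \<le> B"
proof (rule ccontr)
  define N where "N k = (\<Sum>i=1..p. norm (y k i))" for k
  have N_nonneg: "0 \<le> N k" for k by (simp add: N_def sum_nonneg)
  assume "\<not> ?thesis"
  then have unb: "\<exists>k. B < N k" for B by (force simp: N_def not_le)
  have large: "\<exists>k\<ge>K. B < N k" for K B
  proof -
    obtain k where k: "max B (Max (N ` {..K})) < N k" using unb by blast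
    have "K \<le> k"
    proof (rule ccontr)
      assume "\<not> ?thesis"
      then have "N k \<le> Max (N ` {..K})" by (intro Max_ge) auto
      with k show False by linarith
    qed
    with k show ?thesis by auto
  qed
  have "\<exists>r. strict_mono r \<and> (\<lambda>j. inverse (1 + N (r j))) \<longlonglongrightarrow> 0"
  proof (rule subsequence_to_zero)
    show "0 \<le> inverse (1 + N k)" for k using N_nonneg[of k] by simp
    fix e :: real and K assume e: "0 < e"
    then obtain k where k: "K \<le> k" "inverse e < N k" using large by blast
    have "inverse (1 + N k) < inverse (inverse e)"
      by (rule less_imp_inverse_less) (use e k(2) in auto)
    with k(1) show "\<exists>k\<ge>K. inverse (1 + N k) < e" by auto
  qed
  then obtain r where r: "strict_mono r" and inv: "(\<lambda>j. inverse (1 + N (r j))) \<longlonglongrightarrow> 0"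
    by blast
  \<comment> \<open>Dividing by \<open>1 + N k\<close> rather than \<open>N k\<close> avoids the case \<open>N k = 0\<close>; the total norm of \<open>w k\<close> still
    tends to 1.\<close>
  define w where "w k i = inverse (1 + N k) *\<^sub>R y k i" for k i
  have "norm (w k i) \<le> 1" if i: "i \<in> {1..p}" for k i
  proof -
    have "norm (y k i) \<le> N k"
      unfolding N_def by (rule member_le_sum[OF i]) auto
    then show ?thesis
      using N_nonneg[of k] by (simp add: w_def field_simps)
  qed
  then have "bounded (range (\<lambda>k. w (r k) i))" if "i \<in> {1..p}" for i
    using that by (auto simp: bounded_iff)
  then obtain v q where q: "strict_mono q"
    and v: "\<And>i. i \<in> {1..p} \<Longrightarrow> (\<lambda>j. w (r (q j)) i) \<longlonglongrightarrow> v i"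
    using finite_family_convergent_subsequence[of "{1..p}" "\<lambda>k. w (r k)"] by blast
  have rq: "strict_mono (r \<circ> q)" by (rule strict_mono_o[OF r q])
  have inv_q: "(\<lambda>j. inverse (1 + N (r (q j)))) \<longlonglongrightarrow> 0"
    using LIMSEQ_subseq_LIMSEQ[OF inv q] by (simp add: o_def)
  have "v i \<in> normal_cone (E i) xs" if i: "i \<in> {1..p}" for i
    using scaled_limit_in_normal_cone[OF i rq, of "\<lambda>j. inverse (1 + N (r (q j)))"] v[OF i]
N_nonneg
    by (simp add: w_def add_nonneg_nonneg)
  moreover have "(\<Sum>i=1..p. v i) = 0"
  proof (rule LIMSEQ_unique)
    show "(\<lambda>j. \<Sum>i=1..p. w (r (q j)) i) \<longlonglongrightarrow> (\<Sum>i=1..p. v i)"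
      by (intro tendsto_sum v)
    have "(\<lambda>j. x ((r \<circ> q) j) p) \<longlonglongrightarrow> xs"
      using LIMSEQ_subseq_LIMSEQ[OF iterates_converge rq, of p] by (simp add: o_def)
    then have "(\<lambda>j. inverse (1 + N (r (q j))) *\<^sub>R (d - x ((r \<circ> q) j) p)) \<longlonglongrightarrow> 0 *\<^sub>R (d - xs)"
      by (intro tendsto_intros inv_q)
    then show "(\<lambda>j. \<Sum>i=1..p. w (r (q j)) i) \<longlonglongrightarrow> 0"
      unfolding w_def scaleR_sum_right[symmetric] sum_corrections by simp
  qed
  ultimately have zero: "v i = 0" if "i \<in> {1..p}" for i
    using cq that by (auto simp: CQ1_def)
  have "(\<lambda>j. \<Sum>i=1..p. norm (w (r (q j)) i)) \<longlonglongrightarrow> (\<Sum>i=1..p. norm (v i))"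
    by (intro tendsto_sum tendsto_norm v)
  then have "(\<lambda>j. \<Sum>i=1..p. norm (w (r (q j)) i)) \<longlonglongrightarrow> 0"
    using zero by simp
  moreover have "(\<Sum>i=1..p. norm (w k i)) = 1 - inverse (1 + N k)" for k
  proof -
    have "(\<Sum>i=1..p. norm (w k i)) = inverse (1 + N k) * N k"
      using N_nonneg[of k] by (simp add: w_def N_def sum_distrib_left)
    also have "\<dots> = 1 - inverse (1 + N k)"
      using N_nonneg[of k] by (simp add: field_simps)
    finally show ?thesis .
  qed
  ultimately have "(\<lambda>j. 1 - inverse (1 + N (r (q j)))) \<longlonglongrightarrow> 0" by simp
  moreover have "(\<lambda>j. 1 - inverse (1 + N (r (q j)))) \<longlonglongrightarrow> 1 - 0"
    by (intro tendsto_intros inv_q)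
  ultimately show False using LIMSEQ_unique by fastforce
qed

lemma accumulation_point_multiplier:
  assumes "accumulation_point p y a"
  shows "(\<Sum>i=1..p. a i) = d - xs" and "i \<in> {1..p} \<Longrightarrow> a i \<in> normal_cone (E i) xs"
proof -
  obtain r where r: "strict_mono r" and lim: "(\<lambda>j. prod_norm p (\<lambda>i. y (r j) i - a i)) \<longlonglongrightarrow> 0"
    using assms by (auto simp: accumulation_point_def)
  have "(\<lambda>j. y (r j) i) \<longlonglongrightarrow> a i" if i: "i \<in> {1..p}" for i
  proof -
    have "(\<lambda>j. y (r j) i - a i) \<longlonglongrightarrow> 0"
      by (rule Lim_null_comparison[OF _ lim])
         (use member_le_L2_set[OF _ i, of "\<lambda>i. norm (y (r j) i - a i)" for j] in \<open>auto simp: prod_norm_def\<close>)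
    then show ?thesis by (simp add: LIM_zero_iff)
  qed
  from limit_is_multiplier[OF r this]
  show "(\<Sum>i=1..p. a i) = d - xs" and "i \<in> {1..p} \<Longrightarrow> a i \<in> normal_cone (E i) xs" by auto
qed

lemma accumulation_point_exists:
  assumes B: "\<And>k. (\<Sum>i=1..p. norm (y k i)) \<le> B"
  shows "\<exists>a. accumulation_point p y a"
proof -
  have "norm (y k i) \<le> B" if "i \<in> {1..p}" for k i
    using B[of k] member_le_sum[OF that, of "\<lambda>i. norm (y k i)"] by fastforce
  then have "bounded (range (\<lambda>k. y k i))" if "i \<in> {1..p}" for i
    using that by (auto simp: bounded_iff)
  then obtain a r where r: "strict_mono r"
    and a: "\<And>i. i \<in> {1..p} \<Longrightarrow> (\<lambda>j. y (r j) i) \<longlonglongrightarrow> a i"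
    using finite_family_convergent_subsequence[of "{1..p}" y] by blast
  have "(\<lambda>j. \<Sum>i=1..p. norm (y (r j) i - a i)) \<longlonglongrightarrow> (\<Sum>i=1..p. norm (a i - a i))"
    by (intro tendsto_intros a)
  then have lim: "(\<lambda>j. \<Sum>i=1..p. norm (y (r j) i - a i)) \<longlonglongrightarrow> 0" by simp
  have "(\<lambda>j. prod_norm p (\<lambda>i. y (r j) i - a i)) \<longlonglongrightarrow> 0"
  proof (rule tendsto_sandwich[OF _ _ tendsto_const lim]; rule always_eventually; rule allI)
    show "0 \<le> prod_norm p (\<lambda>i. y (r j) i - a i)" for j
      unfolding prod_norm_def by (rule L2_set_nonneg)
    show "prod_norm p (\<lambda>i. y (r j) i - a i) \<le> (\<Sum>i=1..p. norm (y (r j) i - a i))" for j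
      unfolding prod_norm_def by (rule L2_set_le_sum) simp
  qed
  with r show ?thesis by (auto simp: accumulation_point_def)
qed

end

section \<open>Multipliers and dual minimizers\<close>

text \<open>
  Bounding each support function from below by its value at \<open>xs\<close> gives the lower bound
  \<open>1/2 |xs|\<^sup>2 + (d - xs) \<bullet> xs\<close> for the dual objective; it is attained at \<open>a\<close>, because a normal vector at
  \<open>xs\<close> attains its support function there.
\<close>

lemma multiplier_minimizes_h_dual:
  assumes xs: "\<And>i. i \<in> {1..p} \<Longrightarrow> xs \<in> E i"
    and a: "\<And>i. i \<in> {1..p} \<Longrightarrow> a i \<in> normal_cone (E i) xs"
    and sum_a: "(\<Sum>i=1..p. a i) = d - xs"
  shows "minimizer (h_dual p E d) a"
  unfolding minimizer_def
proof
  fix y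
  have "h_dual p E d a \<le> ereal (1/2 * (norm xs)\<^sup>2) + (\<Sum>i=1..p. ereal (a i \<bullet> xs))"
    unfolding h_dual_def sum_a support_fun_def
    by (intro add_mono sum_mono SUP_least)
       (use a in \<open>auto simp: normal_cone_def inner_diff_right\<close>)
  also have "\<dots> = ereal (1/2 * (norm xs)\<^sup>2 + (d - xs) \<bullet> xs)"
    unfolding sum_a[symmetric] by (simp add: inner_sum_left)
  also have "\<dots> \<le> ereal (1/2 * (norm (d - (\<Sum>i=1..p. y i)))\<^sup>2 + (\<Sum>i=1..p. y i) \<bullet> xs)"
  proof -
    define s where "s = (\<Sum>i=1..p. y i)"
    have "0 \<le> 1/2 * ((d - s - xs) \<bullet> (d - s - xs))" by simp
    then show ?thesis
      unfolding s_def[symmetric] power2_norm_eq_inner by (simp add: inner_simps inner_commute field_simps)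
  qed
  also have "\<dots> = ereal (1/2 * (norm (d - (\<Sum>i=1..p. y i)))\<^sup>2) + (\<Sum>i=1..p. ereal (y i \<bullet> xs))"
    by (simp add: inner_sum_left)
  also have "\<dots> \<le> h_dual p E d y"
    unfolding h_dual_def support_fun_def
    by (intro add_mono sum_mono SUP_upper order_refl xs)
  finally show "h_dual p E d a \<le> h_dual p E d y" .
qed

lemma SUP_norm_diff_finite:
  fixes y :: "nat \<Rightarrow> nat \<Rightarrow> 'a::euclidean_space"
  assumes "\<And>k. (\<Sum>i=1..p. norm (y k i)) \<le> B" and "i \<in> {1..p}"
  shows "(SUP k. ereal (norm (y k i - c))) < \<infinity>"
proof -
  have "norm (y k i - c) \<le> B + norm c" for k
  proof -
    have "norm (y k i) \<le> (\<Sum>i=1..p. norm (y k i))"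
      by (rule member_le_sum[OF assms(2)]) auto
    with assms(1)[of k] norm_triangle_ineq4[of "y k i" c] show ?thesis by linarith
  qed
  then have "(SUP k. ereal (norm (y k i - c))) \<le> ereal (B + norm c)"
    by (intro SUP_least) simp
  then show ?thesis by (rule le_less_trans) simp
qed

lemma bounded_seqI:
  assumes "\<And>k. (\<Sum>i=1..p. norm (y k i)) \<le> B"
  shows "bounded_seq p y"
  unfolding bounded_seq_def prod_norm_def
  by (rule exI[of _ B], rule allI, rule order_trans[OF L2_set_le_sum assms]) simp

section \<open>Dykstra's algorithm and its extension\<close>

lemma closest_point_normal:
  assumes "closed S" "convex S" "c \<in> S" "u = closest_point S z"
  shows "(z - u) \<bullet> (c - u) \<le> 0"
  using closest_point_dot[OF assms(2,1,3)] assms(4) by simp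

lemma dykstra_cyclic_correction_run:
  assumes run: "dykstra m C d x y z"
    and closed: "\<And>i. i \<in> {1..m} \<Longrightarrow> closed (C i)"
    and convex: "\<And>i. i \<in> {1..m} \<Longrightarrow> convex (C i)"
    and xs_in: "xs \<in> (\<Inter>i\<in>{1..m}. C i)"
    and xs_proj: "\<And>c. c \<in> (\<Inter>i\<in>{1..m}. C i) \<Longrightarrow> (d - xs) \<bullet> (c - xs) \<le> 0"
  shows "cyclic_correction_run m m C d xs x y"
proof -
  have ne: "C i \<noteq> {}" if "i \<in> {1..m}" for i using xs_in that by auto
  have one: "1 \<le> Suc k" for k by simp
  note iteration = run[unfolded dykstra_def, THEN conjunct2, THEN spec, THEN mp, OF one,
      unfolded diff_Suc_1]
  have step: "z (Suc k) i = x (Suc k) (i - 1) + y k i"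
      "x (Suc k) i = closest_point (C i) (z (Suc k) i)"
      "y (Suc k) i = z (Suc k) i - x (Suc k) i" if "i \<in> {1..m}" for k i
    using iteration[of k] that by blast+
  have feas: "x (Suc k) i \<in> C i" if "i \<in> {1..m}" for k i
    using step(2)[OF that, of k] closest_point_in_set[OF closed[OF that] ne[OF that]] by simp
  have norm: "y (Suc k) i \<bullet> (c - x (Suc k) i) \<le> 0" if "i \<in> {1..m}" "c \<in> C i" for k i c
    using closest_point_normal[OF closed convex that(2) step(2)] step(3) that(1) by simp
  show ?thesis
  proof
    show "x 0 m = d - (\<Sum>i=1..m. y 0 i)"
      using run unfolding dykstra_def by blast
    show "x (Suc k) 0 = x k m" for k
      using iteration[of k] by blast
    show "y (Suc k) i = y k i + (x (Suc k) (i - 1) - x (Suc k) i)" if "i \<in> {1..m}" for k i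
      using step[OF that, of k] by simp
    show "y (Suc k) i \<bullet> (x (Suc (Suc k)) i - x (Suc k) i) \<le> 0" if "i \<in> {1..m}" for k i
      by (rule norm[OF that feas[OF that]])
  qed (fact closed order_refl INT_lower xs_in xs_proj norm feas)+
qed

text \<open>
  The cold start, with all corrections zero; \<open>inner\<close> computes the points of one cycle and \<open>sweep\<close> the
  points and corrections after it.
\<close>

lemma dykstra_run_exists:
  "\<exists>x y z. dykstra m C d x y z"
proof -
  define inner where "inner x0 c = rec_nat x0 (\<lambda>i u. closest_point (C (Suc i)) (u + c (Suc i)))"
    for x0 :: 'a and c :: "nat \<Rightarrow> 'a"
  define sweep where "sweep s = (let u = inner (fst s m) (snd s)
      in (u, \<lambda>i. u (i - 1) + snd s i - u i))" for s :: "(nat \<Rightarrow> 'a) \<times> (nat \<Rightarrow> 'a)"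
  define state where "state = rec_nat (\<lambda>_. d, \<lambda>_. 0) (\<lambda>_. sweep)"
  define x where "x k = fst (state k)" for k
  define y where "y k = snd (state k)" for k
  define z where "z k i = x k (i - 1) + y (k - 1) i" for k i
  have x_Suc: "x (Suc k) = inner (x k m) (y k)" 
    and y_Suc: "y (Suc k) = (\<lambda>i. x (Suc k) (i - 1) + y k i - x (Suc k) i)" for k
    by (simp_all add: x_def y_def state_def sweep_def Let_def)
  have "x (Suc k) i = closest_point (C i) (z (Suc k) i)" if "i \<in> {1..m}" for k i
  proof -
    obtain j where "i = Suc j" using \<open>i \<in> {1..m}\<close> by (cases i) auto
    then show ?thesis by (simp add: z_def x_Suc inner_def)
  qed
  moreover have "x (Suc k) 0 = x k m" for k by (simp add: x_Suc inner_def)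
  moreover have "y (Suc k) i = z (Suc k) i - x (Suc k) i" for k i
    by (simp add: z_def y_Suc)
  moreover have "x 0 m = d - (\<Sum>i=1..m. y 0 i)" by (simp add: x_def y_def state_def)
  moreover have "z (Suc k) i = x (Suc k) (i - 1) + y k i" for k i by (simp add: z_def)
  ultimately have "dykstra m C d x y z"
    unfolding dykstra_def by (auto simp: Suc_le_eq gr0_conv_Suc)
  then show ?thesis by blast
qed

text \<open>
  As \<open>v\<close> is normal to the intersection at \<open>xs\<close>, the projection of \<open>xs + v\<close> is \<open>xs\<close>.  The corrections of
  Dykstra's algorithm for the point \<open>xs + v\<close> accumulate at normals of the single sets whose sum is
  \<open>(xs + v) - xs\<close>.
\<close>

lemma normal_cone_inter_decomposition:
  assumes closed: "\<And>i. i \<in> {1..m} \<Longrightarrow> closed (C i)"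
    and convex: "\<And>i. i \<in> {1..m} \<Longrightarrow> convex (C i)"
    and xs_in: "xs \<in> (\<Inter>i\<in>{1..m}. C i)"
    and cq: "CQ1 m C xs"
    and v: "v \<in> normal_cone (\<Inter>i\<in>{1..m}. C i) xs"
  obtains a where "\<And>i. i \<in> {1..m} \<Longrightarrow> a i \<in> normal_cone (C i) xs" "(\<Sum>i=1..m. a i) = v"
proof -
  obtain x y z where "dykstra m C (xs + v) x y z" using dykstra_run_exists by blast
  then interpret cyclic_correction_run m m C "xs + v" xs x y
    by (rule dykstra_cyclic_correction_run[OF _ closed convex xs_in])
       (use v in \<open>auto simp: normal_cone_def\<close>)
  obtain a where "accumulation_point m y a"
    using corrections_bounded[OF cq] accumulation_point_exists by blast
  from accumulation_point_multiplier[OF this] show ?thesis by (intro that) auto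
qed

text \<open>
  At the additional index, \<open>descent\<close> holds because the set \<open>D (k + 1)\<close> chosen next lies in the
  halfspace \<open>H k\<close>, and normality holds with respect to the intersection because every \<open>D k\<close> contains it.
\<close>

lemma extended_dykstra_cyclic_correction_run:
  assumes run: "extended_dykstra m C d x y z D H"
    and closed: "\<And>i. i \<in> {1..m} \<Longrightarrow> closed (C i)"
    and convex: "\<And>i. i \<in> {1..m} \<Longrightarrow> convex (C i)"
    and xs_in: "xs \<in> (\<Inter>i\<in>{1..m}. C i)"
    and xs_proj: "\<And>c. c \<in> (\<Inter>i\<in>{1..m}. C i) \<Longrightarrow> (d - xs) \<bullet> (c - xs) \<le> 0"
  shows "cyclic_correction_run m (m+1) (C(m+1 := \<Inter>i\<in>{1..m}. C i)) d xs x y"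
proof -
  let ?K = "\<Inter>i\<in>{1..m}. C i"
  let ?E = "C(m+1 := ?K)"
  have ne: "C i \<noteq> {}" if "i \<in> {1..m}" for i using xs_in that by auto
  have one: "1 \<le> Suc k" for k by simp
  note iteration = run[unfolded extended_dykstra_def, THEN conjunct2, THEN conjunct2, THEN conjunct2,
      THEN spec, THEN mp, OF one, unfolded diff_Suc_1]
  have step: "z (Suc k) i = x (Suc k) (i - 1) + y k i"
      "x (Suc k) i = closest_point (C i) (z (Suc k) i)"
      "y (Suc k) i = z (Suc k) i - x (Suc k) i" if "i \<in> {1..m}" for k i
    using iteration[of k] that by blast+
  have last: "z (Suc k) (m+1) = x (Suc k) m + y k (m+1)"
      "x (Suc k) (m+1) = closest_point (D (Suc k)) (z (Suc k) (m+1))"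
      "y (Suc k) (m+1) = z (Suc k) (m+1) - x (Suc k) (m+1)"
      "closed (D (Suc k))" "convex (D (Suc k))" "?K \<subseteq> D (Suc k)" "D (Suc k) \<subseteq> H k"
      "H (Suc k) = {u. y (Suc k) (m+1) \<bullet> (u - x (Suc k) (m+1)) \<le> 0}" for k
    using iteration[of k] by blast+
  have feas: "x (Suc k) i \<in> C i" if "i \<in> {1..m}" for k i
    using step(2)[OF that, of k] closest_point_in_set[OF closed[OF that] ne[OF that]] by simp
  have norm: "y (Suc k) i \<bullet> (c - x (Suc k) i) \<le> 0" if "i \<in> {1..m}" "c \<in> C i" for k i c
    using closest_point_normal[OF closed convex that(2) step(2)] step(3) that(1) by simp
  have last_norm: "y (Suc k) (m+1) \<bullet> (c - x (Suc k) (m+1)) \<le> 0" if "c \<in> ?K" for k c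
    using closest_point_normal[OF last(4,5) subsetD[OF last(6) that] last(2)] last(1,3) by simp
  have last_desc: "y (Suc k) (m+1) \<bullet> (x (Suc (Suc k)) (m+1) - x (Suc k) (m+1)) \<le> 0" for k
  proof -
    have "D (Suc (Suc k)) \<noteq> {}" using last(6) xs_in by blast
    then have "x (Suc (Suc k)) (m+1) \<in> D (Suc (Suc k))"
      using closest_point_in_set[OF last(4)] last(2) by metis
    then have "x (Suc (Suc k)) (m+1) \<in> H (Suc k)" using last(7) by blast
    then show ?thesis unfolding last(8) by simp
  qed
  have E_old: "?E i = C i" if "i \<in> {1..m}" for i using that by simp
  have K_eq: "(\<Inter>i\<in>{1..m}. ?E i) = ?K" by simp
  have cases: "i \<in> {1..m} \<or> i = m + 1" if "i \<in> {1..m+1}" for i using that by auto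
  show ?thesis
    unfolding cyclic_correction_run_def K_eq
  proof (intro conjI allI impI)
    show "x 0 (m+1) = d - (\<Sum>i=1..m+1. y 0 i)"
      using run unfolding extended_dykstra_def by blast
    show "x (Suc k) 0 = x k (m+1)" for k
      using iteration[of k] by blast
    show "y (Suc k) i = y k i + (x (Suc k) (i - 1) - x (Suc k) i)" if "i \<in> {1..m+1}" for k i
      using cases[OF that]
    proof
      assume "i \<in> {1..m}"
      from step(1,3)[OF this, of k] show ?thesis by (simp add: algebra_simps)
    next
      assume "i = m + 1"
      with last(1,3)[of k] show ?thesis by (simp add: algebra_simps)
    qed
    show "y (Suc k) i \<bullet> (c - x (Suc k) i) \<le> 0" if "i \<in> {1..m+1}" "c \<in> ?E i" for k i c
      using cases[OF that(1)]
    proof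
      assume "i \<in> {1..m}"
      with norm[OF this] E_old[OF this] that(2) show ?thesis by blast
    next
      assume "i = m + 1"
      with last_norm that(2) show ?thesis by (simp only: fun_upd_same)
    qed
    show "y (Suc k) i \<bullet> (x (Suc (Suc k)) i - x (Suc k) i) \<le> 0" if "i \<in> {1..m+1}" for k i
      using cases[OF that] norm feas last_desc by blast
    show "?K \<subseteq> ?E i" if "i \<in> {1..m+1}" for i
      using cases[OF that] by auto
    show "closed (?E i)" "x (Suc k) i \<in> ?E i" if "i \<in> {1..m}" for k i
      using E_old[OF that] closed[OF that] feas[OF that] by simp_all
  qed (use xs_in xs_proj in simp_all)
qed

lemma CQ2_iff_CQ1_extended:
  "CQ2 m C xs \<longleftrightarrow> CQ1 (m+1) (C(m+1 := \<Inter>i\<in>{1..m}. C i)) xs"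
proof -
  have "(\<forall>i\<in>{1..m+1}. v i \<in> normal_cone ((C(m+1 := \<Inter>i\<in>{1..m}. C i)) i) xs)
      \<longleftrightarrow> v (m+1) \<in> normal_cone (\<Inter>i\<in>{1..m}. C i) xs \<and> (\<forall>i\<in>{1..m}. v i \<in> normal_cone (C i) xs)" for v
    by (auto simp del: One_nat_def simp: le_Suc_eq)
  then show ?thesis unfolding CQ1_def CQ2_def by presburger
qed

lemma hbar_dual_eq_h_dual_extended:
  "hbar_dual m C d = h_dual (m+1) (C(m+1 := \<Inter>i\<in>{1..m}. C i)) d"
  by (rule ext) (simp add: hbar_dual_def h_dual_def add.assoc)

lemma CQ2_imp_CQ1: "CQ2 m C xs \<Longrightarrow> CQ1 m C xs"
  unfolding CQ1_def
proof (intro allI impI ballI, elim conjE)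
  fix v i
  assume cq: "CQ2 m C xs" and v: "(\<Sum>i=1..m. v i) = 0" "\<forall>i\<in>{1..m}. v i \<in> normal_cone (C i) xs"
    and i: "i \<in> {1..m}"
  have "\<forall>i\<in>{1..m+1}. (v(m+1 := 0)) i = 0"
    using cq[unfolded CQ2_def, rule_format, of "v(m+1 := 0)"] v by (auto simp: normal_cone_def)
  with i show "v i = 0" by (auto dest: bspec[of _ _ i])
qed

lemma normal_cone_add:
  "v \<in> normal_cone S a \<Longrightarrow> w \<in> normal_cone S a \<Longrightarrow> v + w \<in> normal_cone S a"
  by (force simp: normal_cone_def inner_add_left)

lemma pointed_normal_cone:
  assumes "\<not> contains_line (normal_cone S a)" "v \<in> normal_cone S a" "- v \<in> normal_cone S a"
  shows "v = 0"
proof (rule ccontr)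
  assume "v \<noteq> 0"
  have "v \<bullet> (c - a) = 0" if "c \<in> S" for c
    using assms(2,3) that by (force simp: normal_cone_def)
  then have "range (\<lambda>t::real. 0 + t *\<^sub>R v) \<subseteq> normal_cone S a"
    by (auto simp: normal_cone_def)
  with \<open>v \<noteq> 0\<close> assms(1) show False unfolding contains_line_def by blast
qed

lemma CQ1_imp_CQ2:
  assumes closed: "\<And>i. i \<in> {1..m} \<Longrightarrow> closed (C i)"
    and convex: "\<And>i. i \<in> {1..m} \<Longrightarrow> convex (C i)"
    and xs_in: "xs \<in> (\<Inter>i\<in>{1..m}. C i)"
    and pointed: "\<And>i. i \<in> {1..m} \<Longrightarrow> \<not> contains_line (normal_cone (C i) xs)"
    and cq: "CQ1 m C xs"
  shows "CQ2 m C xs"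
  unfolding CQ2_def
proof (intro allI impI, elim conjE)
  fix v
  assume v_sum: "(\<Sum>i=1..m+1. v i) = 0" and v_last: "v (m+1) \<in> normal_cone (\<Inter>i\<in>{1..m}. C i) xs"
    and v: "\<forall>i\<in>{1..m}. v i \<in> normal_cone (C i) xs"
  \<comment> \<open>Absorbing the decomposition of the last vector leaves a relation between normals of the \<open>C i\<close>.\<close>
  obtain a where a: "\<And>i. i \<in> {1..m} \<Longrightarrow> a i \<in> normal_cone (C i) xs" and a_sum: "(\<Sum>i=1..m. a i) = v (m+1)"
    using normal_cone_inter_decomposition[OF closed convex xs_in cq v_last] by blast
  have "(\<Sum>i=1..m. v i + a i) = 0" using v_sum a_sum by (simp add: sum.distrib)
  moreover have "\<forall>i\<in>{1..m}. v i + a i \<in> normal_cone (C i) xs"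
    using v a by (auto intro: normal_cone_add)
  ultimately have "\<forall>i\<in>{1..m}. v i + a i = 0"
    using cq[unfolded CQ1_def, rule_format, of "\<lambda>i. v i + a i"] by blast
  then have neg: "a i = - v i" if "i \<in> {1..m}" for i
    using that by (simp add: eq_neg_iff_add_eq_0 add.commute)
  have zero: "v i = 0" if "i \<in> {1..m}" for i
    using pointed_normal_cone[OF pointed[OF that]] v a[OF that] neg[OF that] that by auto
  moreover have "v (m+1) = 0" using v_sum zero by simp
  ultimately show "\<forall>i\<in>{1..m+1}. v i = 0" by (auto simp: le_Suc_eq)
qed

theorem theorem4p6:
  fixes C :: "nat \<Rightarrow> (real ^ 'n) set" and d xs :: "real ^ 'n" and m :: nat
  assumes "m \<ge> 1"
    and "\<And>i. i \<in> {1..m} \<Longrightarrow> closed (C i)"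
    and "\<And>i. i \<in> {1..m} \<Longrightarrow> convex (C i)"
    and "(\<Inter>i\<in>{1..m}. C i) \<noteq> {}"
    and "xs = closest_point (\<Inter>i\<in>{1..m}. C i) d"
  shows
    "(CQ1 m C xs \<longrightarrow>
       (\<forall>x y z. dykstra m C d x y z \<longrightarrow>
          bounded_seq m y \<and>
          (\<exists>a. accumulation_point m y a) \<and>
          (\<forall>a. accumulation_point m y a \<longrightarrow> minimizer (h_dual m C d) a) \<and>
          (\<exists>ys. minimizer (h_dual m C d) ys \<and>
             (\<forall>i\<in>{1..m-1}. (SUP k. ereal (norm (y k i - ys i))) < \<infinity>)))) \<and>
     (CQ2 m C xs \<longrightarrow>
       (\<forall>x y z D H. extended_dykstra m C d x y z D H \<longrightarrow>
          bounded_seq (m+1) y \<and>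
          (\<exists>a. accumulation_point (m+1) y a) \<and>
          (\<forall>a. accumulation_point (m+1) y a \<longrightarrow> minimizer (hbar_dual m C d) a) \<and>
          (\<exists>ys. minimizer (h_dual m C d) ys \<and>
             (\<forall>i\<in>{1..m+1}. (SUP k. ereal (norm (y k i - (ys(m+1 := 0)) i))) < \<infinity>)))) \<and>
     ((\<forall>i\<in>{1..m}. \<not> contains_line (normal_cone (C i) xs)) \<longrightarrow>
       (CQ1 m C xs \<longleftrightarrow> CQ2 m C xs))"
proof (intro conjI impI allI)
  let ?K = "\<Inter>i\<in>{1..m}. C i"
  let ?E = "C(m+1 := ?K)"
  have clK: "closed ?K" and cvK: "convex ?K"
    using assms(2,3) by (auto intro: closed_INT convex_INT)
  have xs_in: "xs \<in> ?K"
    using closest_point_in_set[OF clK assms(4)] assms(5) by simp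
  have proj: "(d - xs) \<bullet> (c - xs) \<le> 0" if "c \<in> ?K" for c
    using closest_point_normal[OF clK cvK that assms(5)] .
  have minimizer_exists: "\<exists>ys. minimizer (h_dual m C d) ys" if cq: "CQ1 m C xs"
  proof -
    have "d - xs \<in> normal_cone ?K xs" using proj by (simp add: normal_cone_def)
    then obtain a where "\<And>i. i \<in> {1..m} \<Longrightarrow> a i \<in> normal_cone (C i) xs" "(\<Sum>i=1..m. a i) = d - xs"
      using normal_cone_inter_decomposition[OF assms(2,3) xs_in cq] by blast
    with xs_in have "minimizer (h_dual m C d) a"
      by (intro multiplier_minimizes_h_dual[of m xs]) auto
    then show ?thesis by blast
  qed
  {
    fix x y z assume cq: "CQ1 m C xs" and run: "dykstra m C d x y z"
    interpret cyclic_correction_run m m C d xs x y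
      by (rule dykstra_cyclic_correction_run[OF run assms(2,3) xs_in proj])
    obtain B where B: "\<And>k. (\<Sum>i=1..m. norm (y k i)) \<le> B"
      using corrections_bounded[OF cq] by blast
    show "bounded_seq m y" by (rule bounded_seqI[OF B])
    show "\<exists>a. accumulation_point m y a" by (rule accumulation_point_exists[OF B])
    show "minimizer (h_dual m C d) a" if "accumulation_point m y a" for a
      using accumulation_point_multiplier[OF that] xs_in_E
      by (intro multiplier_minimizes_h_dual[of m xs]) auto
    show "\<exists>ys. minimizer (h_dual m C d) ys \<and>
        (\<forall>i\<in>{1..m-1}. (SUP k. ereal (norm (y k i - ys i))) < \<infinity>)"
      using minimizer_exists[OF cq] SUP_norm_diff_finite[OF B] by fastforce
  }
  {
    fix x y z D H assume cq: "CQ2 m C xs" and run: "extended_dykstra m C d x y z D H"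
    interpret cyclic_correction_run m "m+1" ?E d xs x y
      by (rule extended_dykstra_cyclic_correction_run[OF run assms(2,3) xs_in proj])
    obtain B where B: "\<And>k. (\<Sum>i=1..m+1. norm (y k i)) \<le> B"
      using corrections_bounded cq[unfolded CQ2_iff_CQ1_extended] by blast
    show "bounded_seq (m+1) y" by (rule bounded_seqI[OF B])
    show "\<exists>a. accumulation_point (m+1) y a" by (rule accumulation_point_exists[OF B])
    show "minimizer (hbar_dual m C d) a" if "accumulation_point (m+1) y a" for a
      unfolding hbar_dual_eq_h_dual_extended
      using accumulation_point_multiplier[OF that] xs_in_E
      by (intro multiplier_minimizes_h_dual[of "m+1" xs]) blast+
    show "\<exists>ys. minimizer (h_dual m C d) ys \<and>
        (\<forall>i\<in>{1..m+1}. (SUP k. ereal (norm (y k i - (ys(m+1 := 0)) i))) < \<infinity>)"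
      using minimizer_exists[OF CQ2_imp_CQ1[OF cq]] SUP_norm_diff_finite[where y = y, OF B] by blast
  }
  show "CQ1 m C xs \<longleftrightarrow> CQ2 m C xs"
    if "\<forall>i\<in>{1..m}. \<not> contains_line (normal_cone (C i) xs)"
    using CQ1_imp_CQ2[OF assms(2,3) xs_in] CQ2_imp_CQ1 that by blast
qed

end
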